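(* For every $n$ and every deterministic exploration strategy using $k=n$ agents, there exists a rooted tree $T$ on $n$ vertices and with height $D=\omega(1)$ (i.e. $D=D(n)\to\infty$ as $n\to\infty$) such that the strategy needs at least $D^2/3$ rounds to explore $T$.
   Context: Collaborative tree exploration: a rooted tree $T$ is initially unknown. A team of $k$ agents all start at the root. Time proceeds in synchronous rounds; in each round every agent either stays at its current vertex or moves along an edge incident to its current vertex. The edges incident to a vertex are revealed when that vertex is visited for the first time. Agents may communicate globally and have unlimited memory and computational power; strategies are deterministic. Exploration is complete once every vertex has been visited; a strategy "needs at least $t$ rounds" if it has not completed exploration before round $t$. The height of a rooted tree is the maximum distance from the root to a vertex. *)

theory Defs
  imports Complex_Main
begin

text \<open>Undirected simple graphs: a vertex set together with a set of two-element sets of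
  vertices. (The predicate \<open>tree\<close> of the AFP entry Graph Theory forbids directed cycles only, so a
  symmetric digraph with at least one edge never satisfies it; hence it is not used here.)\<close>

definition simple_graph :: "'v set \<Rightarrow> 'v set set \<Rightarrow> bool" where
  "simple_graph V E \<longleftrightarrow> finite V \<and> E \<subseteq> {{u, v} | u v. u \<in> V \<and> v \<in> V \<and> u \<noteq> v}"

definition walk :: "'v set set \<Rightarrow> 'v \<Rightarrow> 'v list \<Rightarrow> 'v \<Rightarrow> bool" where
  "walk E u p v \<longleftrightarrow> p \<noteq> [] \<and> hd p = u \<and> last p = v \<and>
     (\<forall>i. Suc i < length p \<longrightarrow> {p ! i, p ! Suc i} \<in> E)"

definition connected_graph :: "'v set \<Rightarrow> 'v set set \<Rightarrow> bool" where
  "connected_graph V E \<longleftrightarrow> (\<forall>u\<in>V. \<forall>v\<in>V. \<exists>p. walk E u p v)"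

definition acyclic_graph :: "'v set set \<Rightarrow> bool" where
  "acyclic_graph E \<longleftrightarrow>
     \<not> (\<exists>u p v. walk E u p v \<and> distinct p \<and> 3 \<le> length p \<and> {v, u} \<in> E)"

definition rooted_tree :: "'v set \<Rightarrow> 'v set set \<Rightarrow> 'v \<Rightarrow> bool" where
  "rooted_tree V E r \<longleftrightarrow> simple_graph V E \<and> connected_graph V E \<and> acyclic_graph E \<and> r \<in> V"

definition graph_dist :: "'v set set \<Rightarrow> 'v \<Rightarrow> 'v \<Rightarrow> nat" where
  "graph_dist E u v = (LEAST d. \<exists>p. walk E u p v \<and> length p = Suc d)"

definition height :: "'v set \<Rightarrow> 'v set set \<Rightarrow> 'v \<Rightarrow> nat" where
  "height V E r = Max (graph_dist E r ` V)"

text \<open>The positions of a team of \<open>k\<close> agents form a list of length \<open>k\<close>. A history lists the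
  positions at the beginning and after each round so far. Vertices are distinguishable, by their
  names of type \<open>'v\<close>. A deterministic strategy with global communication and unlimited memory
  determines the next positions of all agents from the history and the set of edges revealed so
  far. The edges known at earlier times are a function of these two, so nothing is lost by
  omitting them.\<close>

type_synonym 'v history = "'v list list"
type_synonym 'v strategy = "'v history \<Rightarrow> 'v set set \<Rightarrow> 'v list"

definition visited :: "'v history \<Rightarrow> 'v set" where
  "visited h = (\<Union>ps\<in>set h. set ps)"

definition revealed_edges :: "'v set set \<Rightarrow> 'v history \<Rightarrow> 'v set set" where
  "revealed_edges E h = {e \<in> E. e \<inter> visited h \<noteq> {}}"

text \<open>All edges at the current position of an agent are revealed, so requiring the moves to use
  revealed edges is no restriction. Requiring legal moves also on inputs that arise in no
  exploration is harmless, as the agents can stay put there.\<close>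

definition exploration_strategy :: "nat \<Rightarrow> 'v strategy \<Rightarrow> bool" where
  "exploration_strategy k \<sigma> \<longleftrightarrow>
     (\<forall>h K. h \<noteq> [] \<and> length (last h) = k \<longrightarrow>
        length (\<sigma> h K) = k \<and>
        (\<forall>i<k. \<sigma> h K ! i = last h ! i \<or> {last h ! i, \<sigma> h K ! i} \<in> K))"

primrec run :: "nat \<Rightarrow> 'v strategy \<Rightarrow> 'v set set \<Rightarrow> 'v \<Rightarrow> nat \<Rightarrow> 'v history" where
  "run k \<sigma> E r 0 = [replicate k r]"
| "run k \<sigma> E r (Suc t) =
     run k \<sigma> E r t @ [\<sigma> (run k \<sigma> E r t) (revealed_edges E (run k \<sigma> E r t))]"

definition explored_after ::
    "nat \<Rightarrow> 'v strategy \<Rightarrow> 'v set \<Rightarrow> 'v set set \<Rightarrow> 'v \<Rightarrow> nat \<Rightarrow> bool" where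
  "explored_after k \<sigma> V E r t \<longleftrightarrow> V \<subseteq> visited (run k \<sigma> E r t)"

definition needs_at_least ::
    "nat \<Rightarrow> 'v strategy \<Rightarrow> 'v set \<Rightarrow> 'v set set \<Rightarrow> 'v \<Rightarrow> real \<Rightarrow> bool" where
  "needs_at_least k \<sigma> V E r x \<longleftrightarrow> (\<forall>t. real t < x \<longrightarrow> \<not> explored_after k \<sigma> V E r t)"

end

theory Submission
  imports Defs
begin

text \<open>An adversary builds the tree level by level. It maintains a set of branches at the root, each
  with an unvisited vertex at the current depth \<open>d\<close>. To advance, it keeps the small fraction of
  branches that hold few agents, and gives the unvisited vertices there so many children that these
  agents cannot visit all of them in \<open>d\<close> rounds. All other agents have to come through the root and
  need at least \<open>d + 1\<close> rounds. Hence, the frontier of depth \<open>D\<close> is not explored within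
  \<open>1 + 2 + \<dots> + (D - 1)\<close> rounds. Each level costs a constant factor (depending on \<open>D\<close>) in the
  number of branches, so this works whenever \<open>n\<close> is large enough in terms of \<open>D\<close>.\<close>

section \<open>Trees given by parent functions\<close>

text \<open>The guard \<open>v \<le> p v\<close> makes the recursion terminate for every
  \<open>p\<close>; under \<open>parent_fun p\<close> it holds only at the root 0.\<close>

fun depth :: "(nat \<Rightarrow> nat) \<Rightarrow> nat \<Rightarrow> nat" where
  "depth p v = (if v = 0 \<or> v \<le> p v then 0 else Suc (depth p (p v)))"

text \<open>A branch is named by its child of the root. The root itself gets the value 0 and so
  forms a class of its own.\<close>

fun branch :: "(nat \<Rightarrow> nat) \<Rightarrow> nat \<Rightarrow> nat" where
  "branch p v = (if p v = 0 \<or> v \<le> p v then v else branch p (p v))"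

declare depth.simps [simp del] branch.simps [simp del]

text \<open>Vertices are numbered in order of creation: a tree on \<open>{..<N}\<close> grows by
  choosing parents for the numbers from \<open>N\<close> on.\<close>

definition parent_fun :: "(nat \<Rightarrow> nat) \<Rightarrow> bool" where
  "parent_fun p \<longleftrightarrow> (\<forall>v>0. p v < v)"

definition edges :: "(nat \<Rightarrow> nat) \<Rightarrow> nat \<Rightarrow> nat set set" where
  "edges p N = {{v, p v} | v. 0 < v \<and> v < N}"

lemma parent_less: "parent_fun p \<Longrightarrow> 0 < v \<Longrightarrow> p v < v"
  by (simp add: parent_fun_def)

lemma depth_0 [simp]: "depth p 0 = 0"
  by (simp add: depth.simps)

lemma depth_parent: "parent_fun p \<Longrightarrow> 0 < v \<Longrightarrow> depth p v = Suc (depth p (p v))"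
  using parent_less[of p v] by (subst depth.simps) simp

lemma branch_child_of_root: "p v = 0 \<Longrightarrow> branch p v = v"
  by (simp add: branch.simps)

lemma branch_parent: "parent_fun p \<Longrightarrow> 0 < p v \<Longrightarrow> 0 < v \<Longrightarrow> branch p v = branch p (p v)"
  using parent_less[of p v] by (subst branch.simps) simp

text \<open>The recursion only descends to smaller numbers, so vertices appended later leave old
  depths unchanged.\<close>

lemma depth_cong:
  assumes "parent_fun p" "parent_fun q" "\<And>v. v < N \<Longrightarrow> p v = q v"
  shows "v < N \<Longrightarrow> depth p v = depth q v"
proof (induction v rule: less_induct)
  case (less v)
  show ?case
  proof (cases "v = 0")
    case False
    then have "p v < v" "p v = q v"
      using assms less.prems by (auto intro: parent_less)
    then show ?thesis
      using less False assms by (simp add: depth_parent)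
  qed simp
qed

lemma branch_cong:
  assumes "parent_fun p" "\<And>v. v < N \<Longrightarrow> p v = q v"
  shows "v < N \<Longrightarrow> branch p v = branch q v"
proof (induction v rule: less_induct)
  case (less v)
  then show ?case
    using assms(2)[of v] less.IH[of "p v"]
    by (subst (1 2) branch.simps) auto
qed

lemma edges_iff:
  "{u, v} \<in> edges p N \<longleftrightarrow> 0 < u \<and> u < N \<and> v = p u \<or> 0 < v \<and> v < N \<and> u = p v"
  by (auto simp: edges_def doubleton_eq_iff)

lemma edges_bound:
  assumes "parent_fun p" "{u, v} \<in> edges p N"
  shows "u < N" "v < N"
  using assms parent_less[of p u] parent_less[of p v] by (auto simp: edges_iff)

lemma depth_adjacent:
  assumes "parent_fun p" "{u, v} \<in> edges p N"
  shows "depth p v \<le> Suc (depth p u)"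
  using assms by (auto simp: edges_iff depth_parent)

text \<open>A vertex whose parent is not the root shares its branch, so an edge between different
  values of \<open>branch\<close> has the root as an endpoint.\<close>

lemma depth_branch_change:
  assumes "parent_fun p" "{u, v} \<in> edges p N" "branch p u \<noteq> branch p v"
  shows "depth p v \<le> 1"
proof -
  consider "0 < u" "v = p u" | "0 < v" "u = p v"
    using assms(2) by (auto simp: edges_iff)
  then show ?thesis
  proof cases
    case 1
    then have "v = 0" using assms branch_parent[of p u] by fastforce
    then show ?thesis by simp
  next
    case 2
    then have "u = 0" using assms branch_parent[of p v] by fastforce
    then show ?thesis using 2 assms(1) by (simp add: depth_parent)
  qed
qed

section \<open>Walks, distances from the root and the tree property\<close>

lemma walk_iff_successively:
  "walk E u q v \<longleftrightarrow>
     q \<noteq> [] \<and> hd q = u \<and> last q = v \<and> successively (\<lambda>a b. {a, b} \<in> E) q"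
  by (auto simp: walk_def successively_conv_nth)

lemma walk_rev: "walk E u q v \<Longrightarrow> walk E v (rev q) u"
  by (auto simp: walk_iff_successively hd_rev last_rev insert_commute)

lemma walk_snoc: "walk E u q v \<Longrightarrow> {v, w} \<in> E \<Longrightarrow> walk E u (q @ [w]) w"
  by (auto simp: walk_iff_successively successively_append_iff)

lemma walk_trans:
  assumes "walk E u q v" "walk E v q' w"
  shows "\<exists>q. walk E u q w"
proof (cases "tl q'")
  case Nil
  then have "v = w" using assms(2) by (cases q') (auto simp: walk_def)
  then show ?thesis using assms(1) by blast
next
  case (Cons a as)
  then have "q' = v # a # as" using assms(2) by (cases q') (auto simp: walk_def)
  then have "walk E u (q @ a # as) w"
    using assms by (auto simp: walk_iff_successively successively_append_iff)
  then show ?thesis by blast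
qed

text \<open>The walk runs through the ancestors of \<open>v\<close>; a list counts vertices rather
  than edges, hence the \<open>Suc\<close>.\<close>

lemma walk_from_root:
  assumes "parent_fun p"
  shows "v < N \<Longrightarrow> \<exists>q. walk (edges p N) 0 q v \<and> length q = Suc (depth p v)"
proof (induction v rule: less_induct)
  case (less v)
  show ?case
  proof (cases "v = 0")
    case True
    then show ?thesis by (auto simp: walk_def intro!: exI[of _ "[0]"])
  next
    case False
    then have "p v < v" "p v < N" using assms less.prems parent_less[of p v] by auto
    with less.IH obtain q where "walk (edges p N) 0 q (p v)" "length q = Suc (depth p (p v))"
      by blast
    then have "walk (edges p N) 0 (q @ [v]) v \<and> length (q @ [v]) = Suc (depth p v)"
      using False assms less.prems by (auto simp: depth_parent edges_iff intro!: walk_snoc)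
    then show ?thesis by blast
  qed
qed

text \<open>Each edge raises the depth by at most one.\<close>

lemma depth_less_length_walk:
  assumes "parent_fun p"
  shows "walk (edges p N) 0 q v \<Longrightarrow> depth p v < length q"
proof (induction q arbitrary: v rule: rev_induct)
  case Nil
  then show ?case by (simp add: walk_def)
next
  case (snoc x q)
  show ?case
  proof (cases "q = []")
    case True
    then show ?thesis using snoc.prems by (auto simp: walk_def)
  next
    case False
    then have "walk (edges p N) 0 q (last q)" "{last q, v} \<in> edges p N"
      using snoc.prems by (auto simp: walk_iff_successively successively_append_iff)
    then show ?thesis using snoc.IH depth_adjacent[OF assms] by fastforce
  qed
qed

lemma graph_dist_eq_depth:
  assumes "parent_fun p" "v < N"
  shows "graph_dist (edges p N) 0 v = depth p v"
  unfolding graph_dist_def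
proof (rule Least_equality)
  show "\<exists>q. walk (edges p N) 0 q v \<and> length q = Suc (depth p v)"
    using walk_from_root assms by blast
  show "depth p v \<le> d" if "\<exists>q. walk (edges p N) 0 q v \<and> length q = Suc d" for d
    using that depth_less_length_walk[OF assms(1)] by fastforce
qed

text \<open>The largest vertex of a cycle would have two smaller neighbours, but only its parent is
  smaller.\<close>

lemma acyclic_edges:
  assumes "parent_fun p"
  shows "acyclic_graph (edges p N)"
  unfolding acyclic_graph_def
proof (intro notI, elim exE conjE)
  fix u q v
  assume w: "walk (edges p N) u q v" and dist: "distinct q" and len: "3 \<le> length q"
    and closing: "{v, u} \<in> edges p N"
  define x where "x = Max (set q)"
  have ne: "q \<noteq> []" and ends: "q ! 0 = u" "q ! (length q - 1) = v"
    and adj: "\<And>i. Suc i < length q \<Longrightarrow> {q ! i, q ! Suc i} \<in> edges p N"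
    using w by (auto simp: walk_def hd_conv_nth last_conv_nth)
  have "x \<in> set q" using ne by (simp add: x_def)
  then obtain i where i: "i < length q" "q ! i = x" by (auto simp: in_set_conv_nth)
  have parent: "q ! j = p x" if "j < length q" "j \<noteq> i" "{x, q ! j} \<in> edges p N" for j
  proof -
    have "q ! j \<noteq> x" using that i dist nth_eq_iff_index_eq by blast
    moreover have "q ! j \<le> x" using that by (simp add: x_def)
    ultimately have "q ! j < x" by simp
    then show ?thesis using that parent_less[OF assms, of "q ! j"] by (auto simp: edges_iff)
  qed
  \<comment> \<open>These are the two cyclic neighbours of position \<open>i\<close>. The closing
    edge serves the ends of the list, and length at least 3 makes the two positions
    distinct.\<close>
  have "\<exists>j j'. j \<noteq> j' \<and> j < length q \<and> j' < length q \<and> j \<noteq> i \<and> j' \<noteq> i \<and>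
      {x, q ! j} \<in> edges p N \<and> {x, q ! j'} \<in> edges p N"
  proof -
    have next_edge: "{x, q ! Suc i} \<in> edges p N" if "Suc i < length q"
      using adj[of i] that i by simp
    have prev_edge: "{x, q ! (i - 1)} \<in> edges p N" if "0 < i"
      using adj[of "i - 1"] that i by (simp add: insert_commute)
    consider "i = 0" | "i = length q - 1" | "0 < i" "Suc i < length q" using i by linarith
    then show ?thesis
    proof cases
      case 1
      then show ?thesis using next_edge closing ends i len
        by (intro exI[of _ 1] exI[of _ "length q - 1"]) (auto simp: insert_commute)
    next
      case 2
      then have "{x, q ! 0} \<in> edges p N" using closing ends i by simp
      then show ?thesis using prev_edge 2 len
        by (intro exI[of _ 0] exI[of _ "i - 1"]) auto
    next
      case 3
      then show ?thesis using next_edge prev_edge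
        by (intro exI[of _ "i - 1"] exI[of _ "Suc i"]) auto
    qed
  qed
  then obtain j j' where "j \<noteq> j'" "j < length q" "j' < length q" "q ! j = p x" "q ! j' = p x"
    using parent by blast
  then show False using dist nth_eq_iff_index_eq by metis
qed

lemma rooted_tree_edges:
  assumes "parent_fun p" "0 < N"
  shows "rooted_tree {..<N} (edges p N) 0"
proof -
  have "\<exists>w. walk (edges p N) u w v" if "u < N" "v < N" for u v
    using walk_from_root[OF assms(1)] that walk_trans walk_rev by meson
  then have "connected_graph {..<N} (edges p N)" by (simp add: connected_graph_def)
  moreover have "simple_graph {..<N} (edges p N)"
    unfolding simple_graph_def
  proof
    show "edges p N \<subseteq> {{u, v} | u v. u \<in> {..<N} \<and> v \<in> {..<N} \<and> u \<noteq> v}"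
    proof
      fix e assume "e \<in> edges p N"
      then obtain v where v: "e = {v, p v}" "0 < v" "v < N" by (auto simp: edges_def)
      then have "p v < v" using parent_less[OF assms(1)] by blast
      then show "e \<in> {{u, v} | u v. u \<in> {..<N} \<and> v \<in> {..<N} \<and> u \<noteq> v}"
        using v by (intro CollectI exI[of _ v] exI[of _ "p v"]) auto
    qed
  qed simp
  ultimately show ?thesis using assms acyclic_edges by (simp add: rooted_tree_def)
qed

lemma height_edges:
  "parent_fun p \<Longrightarrow> height {..<N} (edges p N) 0 = Max (depth p ` {..<N})"
  using graph_dist_eq_depth by (auto simp: height_def intro!: arg_cong[of _ _ Max] image_cong)

section \<open>Runs of a strategy\<close>

definition positions :: "nat \<Rightarrow> 'v strategy \<Rightarrow> 'v set set \<Rightarrow> 'v \<Rightarrow> nat \<Rightarrow> 'v list" where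
  "positions k \<sigma> E r t = last (run k \<sigma> E r t)"

lemma run_nonempty [simp]: "run k \<sigma> E r t \<noteq> []"
  by (cases t) auto

lemma visited_run: "visited (run k \<sigma> E r t) = (\<Union>j\<le>t. set (positions k \<sigma> E r j))"
  by (induction t) (auto simp: visited_def positions_def atMost_Suc)

lemma length_positions: "exploration_strategy k \<sigma> \<Longrightarrow> length (positions k \<sigma> E r t) = k"
  by (induction t) (auto simp: positions_def exploration_strategy_def)

lemma positions_step:
  assumes "exploration_strategy k \<sigma>" "i < k"
  shows "positions k \<sigma> E r (Suc t) ! i = positions k \<sigma> E r t ! i \<or>
    {positions k \<sigma> E r t ! i, positions k \<sigma> E r (Suc t) ! i} \<in> E"
proof -
  let ?h = "run k \<sigma> E r t"
  have "\<sigma> ?h (revealed_edges E ?h) ! i = last ?h ! i \<or>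
      {last ?h ! i, \<sigma> ?h (revealed_edges E ?h) ! i} \<in> revealed_edges E ?h"
    using assms length_positions[OF assms(1), of E r t] run_nonempty[of k \<sigma> E r t]
    unfolding exploration_strategy_def positions_def by blast
  then show ?thesis by (auto simp: positions_def revealed_edges_def)
qed

text \<open>Edges without a visited endpoint are not revealed, so the strategy receives the same
  inputs in both graphs. This lets the adversary fix the tree after watching the run.\<close>

lemma run_cong:
  assumes "E \<subseteq> E'" "\<And>e. e \<in> E' - E \<Longrightarrow> e \<inter> visited (run k \<sigma> E r t) = {}"
  shows "run k \<sigma> E' r t = run k \<sigma> E r t"
  using assms(2)
proof (induction t)
  case (Suc t)
  have disj: "e \<inter> visited (run k \<sigma> E r t) = {}" if "e \<in> E' - E" for e
    using Suc.prems[OF that] by (auto simp: visited_def)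
  then have "revealed_edges E' (run k \<sigma> E r t) = revealed_edges E (run k \<sigma> E r t)"
    using assms(1) by (auto simp: revealed_edges_def)
  then show ?case using Suc.IH[OF disj] by simp
qed simp

lemma positions_less:
  assumes "exploration_strategy k \<sigma>" "parent_fun p" "0 < N" "i < k"
  shows "positions k \<sigma> (edges p N) 0 t ! i < N"
proof (induction t)
  case 0
  then show ?case using assms by (simp add: positions_def)
next
  case (Suc t)
  then show ?case
    using positions_step[OF assms(1,4), of "edges p N" 0 t] edges_bound[OF assms(2)] by metis
qed

lemma visited_less:
  assumes "exploration_strategy k \<sigma>" "parent_fun p" "0 < N"
  shows "visited (run k \<sigma> (edges p N) 0 t) \<subseteq> {..<N}"
  using positions_less[OF assms] length_positions[OF assms(1)]
  by (fastforce simp: visited_run in_set_conv_nth)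

text \<open>An agent outside a branch can only enter it through the root.\<close>

lemma late_arrival:
  assumes "exploration_strategy k \<sigma>" "parent_fun p" "i < k"
    and "branch p (positions k \<sigma> (edges p N) 0 t ! i) \<noteq> b"
  shows "branch p (positions k \<sigma> (edges p N) 0 (t + j) ! i) = b \<Longrightarrow>
    depth p (positions k \<sigma> (edges p N) 0 (t + j) ! i) \<le> j"
proof (induction j)
  case 0
  then show ?case using assms(4) by simp
next
  case (Suc j)
  let ?u = "positions k \<sigma> (edges p N) 0 (t + j) ! i"
  let ?v = "positions k \<sigma> (edges p N) 0 (t + Suc j) ! i"
  have step: "?v = ?u \<or> {?u, ?v} \<in> edges p N"
    using positions_step[OF assms(1,3), of "edges p N" 0 "t + j"] by simp
  show ?case
  proof (cases "branch p ?u = b")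
    case True
    then have "depth p ?u \<le> j" using Suc.IH by simp
    then show ?thesis using step depth_adjacent[OF assms(2)] by fastforce
  next
    case False
    then have "{?u, ?v} \<in> edges p N" "branch p ?u \<noteq> branch p ?v" using step Suc.prems by metis+
    then show ?thesis using depth_branch_change[OF assms(2)] by fastforce
  qed
qed

text \<open>Pigeonhole: the fibres over distinct values \<open>g v\<close> are disjoint sets of
  agents. It bounds the number of crowded branches.\<close>

lemma card_large_fibres:
  fixes f :: "nat \<Rightarrow> 'b"
  assumes "finite B" "inj_on g B" "\<And>v. v \<in> B \<Longrightarrow> k < card {i. i < n \<and> f i = g v}"
  shows "card B * Suc k \<le> n"
proof -
  have "card B * Suc k = (\<Sum>v\<in>B. Suc k)" by simp
  also have "\<dots> \<le> (\<Sum>v\<in>B. card {i. i < n \<and> f i = g v})"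
    using assms(3) by (intro sum_mono) (simp add: Suc_leI)
  also have "\<dots> = card (\<Union>v\<in>B. {i. i < n \<and> f i = g v})"
    using assms(1,2) by (intro card_UN_disjoint[symmetric]) (auto simp: inj_on_def)
  also have "\<dots> \<le> card {..<n}"
    by (intro card_mono) auto
  finally show ?thesis by simp
qed

section \<open>The adversary\<close>

text \<open>No agent has visited the vertices in \<open>S\<close> by time \<open>t\<close>, so the adversary can still add children
  to them without changing the run so far.\<close>

definition stage :: "nat \<Rightarrow> nat strategy \<Rightarrow> nat \<Rightarrow> nat \<Rightarrow> nat \<Rightarrow> nat \<Rightarrow> bool" where
  "stage n \<sigma> d N s t \<longleftrightarrow> (\<exists>p S. parent_fun p \<and> S \<subseteq> {0<..<N} \<and> card S = s \<and>
     inj_on (branch p) S \<and> (\<forall>v\<in>S. depth p v = d) \<and> (\<forall>v<N. depth p v \<le> d) \<and>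
     S \<inter> visited (run n \<sigma> (edges p N) 0 t) = {})"

text \<open>The tree is a star, and at time 0 only its centre is visited. Leaves beyond the first
  \<open>s\<close> serve as padding.\<close>

lemma stage_init:
  assumes "s < N"
  shows "stage n \<sigma> 1 N s 0"
proof -
  have p: "parent_fun (\<lambda>_. 0)" by (simp add: parent_fun_def)
  have "depth (\<lambda>_. 0) v = 1" if "0 < v" for v
    using depth_parent[OF p that] by simp
  then have "depth (\<lambda>_. 0) v \<le> 1" "v \<in> {0<..s} \<Longrightarrow> depth (\<lambda>_. 0) v = 1" for v
    by (cases "v = 0"; auto)+
  moreover have "inj_on (branch (\<lambda>_. 0)) {0<..s}"
    by (simp add: inj_on_def branch_child_of_root)
  moreover have "{0<..s} \<inter> visited (run n \<sigma> (edges (\<lambda>_. 0) N) 0 0) = {}"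
    by (auto simp: visited_def)
  ultimately show ?thesis
    unfolding stage_def using p assms
    by (intro exI[of _ "\<lambda>_. 0"] exI[of _ "{0<..s}"]) auto
qed

text \<open>Keep \<open>s'\<close> branches that hold at most \<open>k\<close> agents each, and give each of their unvisited
  vertices more than \<open>k * d\<close> children. In \<open>d\<close> rounds, the \<open>k\<close> agents cannot visit all of these
  children, and no agent can come from outside the branch.\<close>

lemma stage_step:
  assumes \<sigma>: "exploration_strategy n \<sigma>" and st: "stage n \<sigma> d N s t"
    and s': "0 < s'" "s' \<le> s" and sparse: "n < Suc k * Suc (s - s')"
    and W: "Suc (k * d) * s' \<le> W"
  shows "stage n \<sigma> (Suc d) (N + W) s' (t + d)"
proof -
  obtain p S where p: "parent_fun p" and S: "S \<subseteq> {0<..<N}" "card S = s"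
    and inj: "inj_on (branch p) S" and dS: "\<And>v. v \<in> S \<Longrightarrow> depth p v = d"
    and dN: "\<And>v. v < N \<Longrightarrow> depth p v \<le> d"
    and unv: "S \<inter> visited (run n \<sigma> (edges p N) 0 t) = {}"
    using st unfolding stage_def by blast
  define P where "P = positions n \<sigma> (edges p N) 0 t"
  define I where "I v = {i. i < n \<and> branch p (P ! i) = branch p v}" for v
  define B where "B = {v \<in> S. k < card (I v)}"
  have finS: "finite S" using S(1) finite_subset by blast
  \<comment> \<open>More than \<open>s - s'\<close> crowded branches would hold more than
    \<open>n\<close> agents by \<open>sparse\<close>, so at least \<open>s'\<close> uncrowded ones
    remain.\<close>
  have "card B * Suc k \<le> n"
    using inj finS
    by (intro card_large_fibres[where g = "branch p" and f = "\<lambda>i. branch p (P ! i)"])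
      (auto simp: B_def I_def inj_on_def)
  then have "Suc k * card B < Suc k * Suc (s - s')"
    using sparse by (simp add: mult.commute)
  then have "card B \<le> s - s'" by (metis less_Suc_eq_le mult_less_cancel1)
  moreover have "card (S - B) = s - card B"
    using finS S(2) by (subst card_Diff_subset) (auto simp: B_def)
  ultimately have "s' \<le> card (S - B)" using s' by linarith
  then obtain S' where S': "S' \<subseteq> S - B" "card S' = s'" "finite S'"
    using obtain_subset_with_card_n by metis
  have S'_N: "v < N" "0 < v" if "v \<in> S'" for v using that S S' by auto
  have N0: "0 < N" using S'_N S' s'
    by (metis card.empty ex_in_conv less_nat_zero_code not_gr_zero)
  obtain f where f: "bij_betw f {0..<s'} S'"
    using ex_bij_betw_nat_finite[OF S'(3)] S'(2) by auto
  \<comment> \<open>The new vertices are dealt out cyclically to the vertices of \<open>S'\<close>,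
    so that each gets at least \<open>W div s'\<close> children.\<close>
  define q where "q v = (if N \<le> v then f ((v - N) mod s') else p v)" for v
  have q_S': "q v \<in> S'" if "N \<le> v" for v
    using that f s' by (auto simp: q_def bij_betw_def)
  have q: "parent_fun q"
    unfolding parent_fun_def
  proof (intro allI impI)
    fix v :: nat assume "0 < v"
    then show "q v < v"
      using q_S'[of v] S'_N[of "q v"] parent_less[OF p, of v] by (cases "N \<le> v") (auto simp: q_def)
  qed
  have q_p: "q v = p v" if "v < N" for v using that by (simp add: q_def)
  have depth_old: "depth q v = depth p v" and branch_old: "branch q v = branch p v"
    if "v < N" for v
    using depth_cong[OF q p q_p] branch_cong[OF q q_p] that by blast+
  have depth_new: "depth q v = Suc d" and branch_new: "branch q v = branch p (q v)"
    if "N \<le> v" for v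
    using that N0 q_S'[OF that] S'_N[of "q v"] depth_old[of "q v"] branch_old[of "q v"] dS S'(1)
    by (auto simp: depth_parent[OF q] branch_parent[OF q])
  define E E' where "E = edges p N" and "E' = edges q (N + W)"
  have sub: "E \<subseteq> E'"
    unfolding E_def E'_def edges_def using q_p by fastforce
  \<comment> \<open>A new edge joins a vertex of \<open>S'\<close> to a number from \<open>N\<close>
    on, both unvisited until time \<open>t\<close>.\<close>
  have agree: "run n \<sigma> E' 0 t = run n \<sigma> E 0 t"
  proof (rule run_cong[OF sub])
    fix e assume e: "e \<in> E' - E"
    then obtain v where v: "e = {v, q v}" "0 < v" "v < N + W" by (auto simp: E'_def edges_def)
    then have "N \<le> v" using e q_p[of v] by (fastforce simp: E_def edges_def)
    then show "e \<inter> visited (run n \<sigma> E 0 t) = {}"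
      using v q_S'[of v] S' unv visited_less[OF \<sigma> p N0, of t] by (auto simp: E_def)
  qed
  have P_eq: "positions n \<sigma> E' 0 t = P"
    using agree by (simp add: positions_def P_def E_def)
  have P_less: "P ! i < N" if "i < n" for i
    using positions_less[OF \<sigma> p N0 that] by (simp add: P_def)
  have "\<exists>w. N \<le> w \<and> w < N + W \<and> q w = v \<and> w \<notin> visited (run n \<sigma> E' 0 (t + d))"
    if v: "v \<in> S'" for v
  proof (rule ccontr)
    assume contra: "\<not> ?thesis"
    obtain a where a: "a < s'" "f a = v" using f v by (auto simp: bij_betw_def)
    define child where "child j = N + (j * s' + a)" for j
    have child: "N \<le> child j" "child j < N + W" "q (child j) = v" if "j < Suc (k * d)" for j
    proof -
      have "j * s' + a < Suc j * s'" using a by simp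
      also have "\<dots> \<le> Suc (k * d) * s'" using that by (intro mult_le_mono1) simp
      finally show "child j < N + W" using W by (simp add: child_def)
    qed (use a in \<open>auto simp: child_def q_def\<close>)
    \<comment> \<open>If all children of \<open>v\<close> were visited, each would be the position
      of some agent of \<open>I v\<close> in one of \<open>d\<close> rounds. There are at most
      \<open>k * d\<close> such pairs, fewer than the children.\<close>
    have "child ` {..<Suc (k * d)} \<subseteq>
      (\<lambda>(j, i). positions n \<sigma> E' 0 (t + j) ! i) ` ({1..d} \<times> I v)" (is "_ \<subseteq> ?R")
    proof
      fix w assume "w \<in> child ` {..<Suc (k * d)}"
      then have w: "N \<le> w" "w < N + W" "q w = v" using child by auto
      then have "w \<in> visited (run n \<sigma> E' 0 (t + d))" using contra by blast
      then obtain \<tau> where "\<tau> \<le> t + d" "w \<in> set (positions n \<sigma> E' 0 \<tau>)"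
        by (auto simp: visited_run)
      then obtain i where i: "i < n" "w = positions n \<sigma> E' 0 \<tau> ! i"
        by (auto simp: in_set_conv_nth length_positions[OF \<sigma>])
      have "w \<notin> visited (run n \<sigma> E' 0 t)"
        using agree visited_less[OF \<sigma> p N0, of t] w by (auto simp: E_def)
      then have "t < \<tau>"
        using \<open>w \<in> set (positions n \<sigma> E' 0 \<tau>)\<close> by (force simp: visited_run not_le[symmetric])
      then obtain j where j: "\<tau> = t + j" "j \<in> {1..d}"
        using \<open>\<tau> \<le> t + d\<close> by (intro that[of "\<tau> - t"]) auto
      \<comment> \<open>By \<open>late_arrival\<close>, an outsider is at depth at most
        \<open>j \<le> d\<close> in this branch at time \<open>t + j\<close>, whereas
        \<open>w\<close> has depth \<open>Suc d\<close>.\<close>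
      have "i \<in> I v"
      proof (rule ccontr)
        assume "i \<notin> I v"
        then have "branch q (positions n \<sigma> E' 0 t ! i) \<noteq> branch p v"
          using i P_eq P_less branch_old by (simp add: I_def)
        moreover have "branch q (positions n \<sigma> E' 0 (t + j) ! i) = branch p v"
          using branch_new[OF w(1)] w(3) i j by simp
        ultimately have "depth q w \<le> j"
          using late_arrival[OF \<sigma> q i(1)] i j unfolding E'_def by blast
        then show False using depth_new[OF w(1)] j by simp
      qed
      then show "w \<in> ?R" using i j by force
    qed
    moreover have finI: "finite (I v)" by (simp add: I_def)
    ultimately have "card (child ` {..<Suc (k * d)}) \<le> card ({1..d} \<times> I v)"
      by (intro surj_card_le[of _ _ "\<lambda>(j, i). positions n \<sigma> E' 0 (t + j) ! i"]) auto
    moreover have "inj child" using s' by (auto simp: inj_on_def child_def)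
    then have "card (child ` {..<Suc (k * d)}) = Suc (k * d)"
      by (subst card_image) (auto intro: inj_on_subset)
    moreover have "card (I v) \<le> k" using v S' by (auto simp: B_def)
    then have "card ({1..d} \<times> I v) \<le> k * d" by (simp add: card_cartesian_product mult.commute)
    ultimately show False by linarith
  qed
  \<comment> \<open>One unvisited child per kept branch forms the next frontier.\<close>
  then obtain g where g: "\<And>v. v \<in> S' \<Longrightarrow> N \<le> g v \<and> g v < N + W \<and> q (g v) = v \<and>
      g v \<notin> visited (run n \<sigma> E' 0 (t + d))"
    by metis
  have "inj_on g S'" using g by (metis inj_onI)
  moreover have "inj_on (branch q) (g ` S')"
    using g inj S'(1) branch_new by (auto simp: inj_on_def)
  moreover have "depth q v \<le> Suc d" for v
    using depth_new[of v] depth_old[of v] dN[of v] by (cases "N \<le> v") auto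
  ultimately show ?thesis
    unfolding stage_def using q g S' N0 depth_new
    by (intro exI[of _ q] exI[of _ "g ` S'"]) (force simp: card_image E'_def)
qed

text \<open>The number of branches shrinks by the factor \<open>M\<close> per level, and \<open>k = 4 * M ^ d\<close> is at least
  twice the average number of agents per branch. Every level gets exactly \<open>W\<close> vertices, so the
  first one can be padded in advance to reach \<open>n\<close> vertices at depth \<open>D\<close>.\<close>

lemma stage_reachable:
  assumes \<sigma>: "exploration_strategy n \<sigma>" and M: "M = 4 * D\<^sup>2 + 2" and n: "M ^ D \<le> n"
    and c: "c = n div M ^ D" and W: "W = c * M ^ (D - 1) * (4 * D + 1)"
    and d: "Suc d \<le> D"
  shows "stage n \<sigma> (Suc d) (n - (D - Suc d) * W) (c * M ^ (D - Suc d)) (\<Sum>i\<le>d. i)"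
proof -
  have M2: "2 \<le> M" using M by simp
  then have pow: "0 < M ^ j" for j by simp
  have c1: "1 \<le> c" using n pow[of D] unfolding c by (simp add: div_greater_zero_iff Suc_leI)
  \<comment> \<open>\<open>A\<close> is the number of branches on the first level.\<close>
  define A where "A = c * M ^ (D - 1)"
  have A1: "1 \<le> A" using c1 pow[of "D - 1"] by (simp add: A_def Suc_leI)
  have AM: "A * M \<le> n"
  proof -
    have "A * M = c * M ^ D" using d by (cases D) (auto simp: A_def)
    then show ?thesis by (simp add: c)
  qed
  have WA: "W = A * (4 * D + 1)" by (simp add: W A_def)
  \<comment> \<open>The first \<open>A\<close> branches, the root and \<open>D - 1\<close> further
    levels of \<open>W\<close> vertices must fit into \<open>n\<close>. As \<open>W\<close> is about
    \<open>4 * D * A\<close>, this forces \<open>M\<close> to be quadratic in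
    \<open>D\<close>.\<close>
  have room: "(D - 1) * W + A < n"
  proof -
    obtain e where e: "D = Suc e" using d by (cases D) auto
    have "(D - 1) * (4 * D + 1) + 2 \<le> M" unfolding M e by (simp add: power2_eq_square algebra_simps)
    then have "A * ((D - 1) * (4 * D + 1) + 2) \<le> A * M" by (rule mult_le_mono2)
    then show ?thesis using AM A1 by (simp add: WA algebra_simps)
  qed
  show ?thesis
    using d
  proof (induction d)
    case 0
    then show ?case
      using room stage_init[of A "n - (D - 1) * W" n \<sigma>] by (simp add: A_def less_diff_conv)
  next
    case (Suc d)
    define e where "e = D - Suc (Suc d)"
    have De: "D = e + d + 2" "D - Suc d = Suc e" using Suc.prems by (auto simp: e_def)
    define s' where "s' = c * M ^ e"
    have s'1: "1 \<le> s'" using c1 pow[of e] by (simp add: s'_def Suc_leI)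
    have s: "c * M ^ (D - Suc d) = M * s'" by (simp add: De s'_def)
    have A: "A = s' * M ^ Suc d" by (simp add: A_def De s'_def power_add algebra_simps)
    \<comment> \<open>The factor 4 in \<open>k\<close> covers two losses of a factor 2: the rounding
      in \<open>c\<close>, and the passage from \<open>M * s'\<close> branches to
      \<open>M * s' - s'\<close>.\<close>
    have "n < (c + 1) * M ^ D"
      using dividend_less_div_times[OF pow, of n D] by (simp add: c algebra_simps)
    also have "\<dots> \<le> 2 * c * M ^ D" using c1 by (intro mult_le_mono1) simp
    also have "\<dots> = 4 * M ^ Suc d * s' * M div 2"
      by (simp add: De s'_def power_add algebra_simps)
    also have "\<dots> \<le> 4 * M ^ Suc d * (M * s' - s')"
    proof -
      have "M * s' \<le> 2 * (M * s' - s')" using mult_le_mono1[OF M2, of s'] by linarith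
      then have "4 * M ^ Suc d * (M * s') \<le> 4 * M ^ Suc d * (2 * (M * s' - s'))"
        by (rule mult_le_mono2)
      then show ?thesis by (simp add: mult_ac)
    qed
    also have "\<dots> \<le> Suc (4 * M ^ Suc d) * Suc (M * s' - s')" by (intro mult_le_mono) auto
    finally have sparse: "n < Suc (4 * M ^ Suc d) * Suc (M * s' - s')" .
    \<comment> \<open>The bound \<open>k\<close> grows as the number of branches shrinks:
      \<open>k * s' = 4 * A\<close> on every level, so the same \<open>W\<close> suffices
      throughout.\<close>
    have "Suc (4 * M ^ Suc d * Suc d) * s' = 4 * Suc d * A + s'"
      by (simp add: A algebra_simps)
    also have "\<dots> \<le> 4 * D * A + A"
    proof -
      have "s' \<le> A" using pow[of "Suc d"] by (simp add: A)
      moreover have "4 * Suc d * A \<le> 4 * D * A" using Suc.prems by (intro mult_le_mono1) simp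
      ultimately show ?thesis by linarith
    qed
    finally have cost: "Suc (4 * M ^ Suc d * Suc d) * s' \<le> W" by (simp add: WA algebra_simps)
    have "(D - Suc d) * W \<le> (D - 1) * W" by (intro mult_le_mono1) simp
    then have "(D - Suc d) * W \<le> n" using room by linarith
    then have N: "n - (D - Suc d) * W + W = n - (D - Suc (Suc d)) * W"
      by (simp add: De e_def[symmetric])
    have "stage n \<sigma> (Suc d) (n - (D - Suc d) * W) (M * s') (\<Sum>i\<le>d. i)"
      using Suc s by simp
    from stage_step[OF \<sigma> this _ _ sparse cost]
    have "stage n \<sigma> (Suc (Suc d)) (n - (D - Suc d) * W + W) s' ((\<Sum>i\<le>d. i) + Suc d)"
      using s'1 M2 by simp
    then show ?case unfolding N by (simp add: s'_def e_def)
  qed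
qed

section \<open>From stages to the choice of the height\<close>

definition slow_tree_exists :: "nat \<Rightarrow> nat \<Rightarrow> bool" where
  "slow_tree_exists n D \<longleftrightarrow> (\<forall>\<sigma> :: nat strategy. exploration_strategy n \<sigma> \<longrightarrow>
     (\<exists>V E r. rooted_tree V E r \<and> card V = n \<and> height V E r = D \<and>
        needs_at_least n \<sigma> V E r ((real D)\<^sup>2 / 3)))"

lemma explored_after_mono:
  "explored_after k \<sigma> V E r t \<Longrightarrow> t \<le> t' \<Longrightarrow> explored_after k \<sigma> V E r t'"
  by (fastforce simp: explored_after_def visited_run)

lemma stage_slow_tree:
  assumes "stage n \<sigma> (Suc d) n s (\<Sum>i\<le>d. i)" "0 < s"
  shows "\<exists>V E r. rooted_tree V E r \<and> card V = n \<and> height V E r = Suc d \<and>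
    needs_at_least n \<sigma> V E r ((real (Suc d))\<^sup>2 / 3)"
proof -
  obtain p v where p: "parent_fun p" and v: "v < n" "depth p v = Suc d"
    and max: "\<And>u. u < n \<Longrightarrow> depth p u \<le> Suc d"
    and unv: "v \<notin> visited (run n \<sigma> (edges p n) 0 (\<Sum>i\<le>d. i))"
    using assms unfolding stage_def
    by (metis card_gt_0_iff disjoint_iff equals0I greaterThanLessThan_iff subsetD)
  have "height {..<n} (edges p n) 0 = Suc d"
    unfolding height_edges[OF p] using v max by (intro Max_eqI) (auto intro: image_eqI[of _ _ v])
  moreover have "needs_at_least n \<sigma> {..<n} (edges p n) 0 ((real (Suc d))\<^sup>2 / 3)"
    unfolding needs_at_least_def
  proof (intro allI impI notI)
    fix t assume t: "real t < (real (Suc d))\<^sup>2 / 3" 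
      and explored: "explored_after n \<sigma> {..<n} (edges p n) 0 t"
    have gauss: "2 * real (\<Sum>i\<le>d. i) = real d * (real d + 1)"
      by (induction d) (auto simp: algebra_simps)
    \<comment> \<open>Multiplied by 6, the next inequality becomes
      \<open>0 \<le> d\<^sup>2 - d + 4\<close>, and four times the right side is
      \<open>(2 * d - 1)\<^sup>2 + 15\<close>. The summand 1 is gained because the frontier is still
      unvisited after the full sum of rounds.\<close>
    have "0 \<le> (2 * real d - 1)\<^sup>2" by simp
    then have "(real (Suc d))\<^sup>2 / 3 \<le> real (\<Sum>i\<le>d. i) + 1"
      using gauss by (simp add: power2_eq_square algebra_simps)
    then have "real t < real ((\<Sum>i\<le>d. i) + 1)" using t by simp
    then have "t \<le> (\<Sum>i\<le>d. i)" by (metis Suc_eq_plus1 less_Suc_eq_le of_nat_less_iff)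
    then have "explored_after n \<sigma> {..<n} (edges p n) 0 (\<Sum>i\<le>d. i)"
      by (rule explored_after_mono[OF explored])
    then show False using unv v(1) by (auto simp: explored_after_def)
  qed
  moreover have "rooted_tree {..<n} (edges p n) 0" using rooted_tree_edges[OF p] v by simp
  ultimately show ?thesis by (metis card_lessThan)
qed

text \<open>At the last level no vertices remain reserved, so the stage has exactly \<open>n\<close>
  vertices, and \<open>n div M ^ Suc d\<close> unvisited ones are left.\<close>

lemma slow_tree_exists_large:
  assumes M: "M = 4 * (Suc d)\<^sup>2 + 2" and n: "M ^ Suc d \<le> n"
  shows "slow_tree_exists n (Suc d)"
  unfolding slow_tree_exists_def
proof (intro allI impI)
  fix \<sigma> :: "nat strategy" assume \<sigma>: "exploration_strategy n \<sigma>"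
  have "stage n \<sigma> (Suc d) n (n div M ^ Suc d) (\<Sum>i\<le>d. i)"
    using stage_reachable[OF \<sigma> M n refl refl order_refl]
    by (simp only: diff_self_eq_0 mult_0 diff_zero power_0 mult_1_right)
  moreover have "0 < M ^ Suc d" using M by (intro zero_less_power) linarith
  then have "0 < n div M ^ Suc d" using n by (simp only: div_greater_zero_iff)
  ultimately show "\<exists>V E r. rooted_tree V E r \<and> card V = n \<and> height V E r = Suc d \<and>
      needs_at_least n \<sigma> V E r ((real (Suc d))\<^sup>2 / 3)"
    by (rule stage_slow_tree)
qed

text \<open>Provides a height for small \<open>n\<close> as well: a single vertex if
  \<open>n = 1\<close>, a star otherwise.\<close>

lemma slow_tree_exists_some:
  assumes "1 \<le> n"
  shows "\<exists>D\<le>n. slow_tree_exists n D"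
proof (cases "n = 1")
  case True
  have p: "parent_fun (\<lambda>_. 0)" by (simp add: parent_fun_def)
  have "height {..<1} (edges (\<lambda>_. 0) 1) 0 = 0"
    unfolding height_edges[OF p] by (simp add: lessThan_Suc)
  then have "slow_tree_exists n 0"
    unfolding slow_tree_exists_def needs_at_least_def
    using rooted_tree_edges[OF p, of 1] True
    by (intro allI impI exI[of _ "{..<1}"] exI[of _ "edges (\<lambda>_. 0) 1"] exI[of _ 0]) simp
  then show ?thesis by blast
next
  case False
  then have "stage n \<sigma> (Suc 0) n 1 (\<Sum>i\<le>0. i)" for \<sigma>
    using assms stage_init[of 1 n] by simp
  then have "slow_tree_exists n 1"
    unfolding slow_tree_exists_def using stage_slow_tree[of n _ 0 1] by simp
  then show ?thesis using assms by blast
qed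

theorem theorem3:
  shows "\<exists>D :: nat \<Rightarrow> nat. filterlim D at_top at_top \<and>
    (\<forall>n\<ge>1. \<forall>\<sigma> :: nat strategy. exploration_strategy n \<sigma> \<longrightarrow>
      (\<exists>V E r. rooted_tree V E r \<and> card V = n \<and> height V E r = D n \<and>
        needs_at_least n \<sigma> V E r ((real (D n))\<^sup>2 / 3)))"
proof -
  \<comment> \<open>The height must depend on \<open>n\<close> alone, so it is chosen before the
    strategy. The cap \<open>d \<le> n\<close> ensures that a greatest value exists.\<close>
  define D where "D n = (GREATEST d. d \<le> n \<and> slow_tree_exists n d)" for n
  have "slow_tree_exists n (D n)" if "1 \<le> n" for n
    using GreatestI_ex_nat[of "\<lambda>d. d \<le> n \<and> slow_tree_exists n d" n] slow_tree_exists_some[OF that]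
    by (auto simp: D_def)
  moreover have "filterlim D at_top at_top"
    unfolding filterlim_at_top
  proof
    fix Z
    show "\<forall>\<^sub>F n in at_top. Z \<le> D n"
      \<comment> \<open>The first threshold is \<open>M ^ Suc Z\<close> for height
        \<open>Suc Z\<close>; the second respects the cap.\<close>
      using eventually_ge_at_top[of "(4 * (Suc Z)\<^sup>2 + 2) ^ Suc Z"]
        eventually_ge_at_top[of "Suc Z"]
    proof eventually_elim
      case (elim n)
      then have "Suc Z \<le> D n"
        unfolding D_def using slow_tree_exists_large[OF refl] by (intro Greatest_le_nat[of _ _ n]) auto
      then show ?case by simp
    qed
  qed
  ultimately show ?thesis unfolding slow_tree_exists_def by blast
qed

end
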